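(* Let $\{i,j\}=\{1,2\}$ and let $(S,S_1,S_2)$ be a dense subbilocale of a bilocale $(L,L_1,L_2)$. Then $(S,S_1,S_2)$ is $(i,j)$-Baire (as a bilocale) if and only if it is a relatively $(i,j)$-Baire subbilocale of $(L,L_1,L_2)$.
   Context: A locale is a complete lattice $L$ with $a\wedge\bigvee B=\bigvee\{a\wedge b:b\in B\}$ for all $a\in L$, $B\subseteq L$; $\to$ is its Heyting operation. A subframe of $L$ is a subset closed under all joins and finite meets. A bilocale is a triple $(L,L_1,L_2)$ with $L_1,L_2$ subframes of a locale $L$ such that $a=\bigvee\{a_1\wedge a_2:a_1\in L_1,a_2\in L_2,a_1\wedge a_2\le a\}$ for all $a\in L$. A sublocale of $L$ is a subset $S$ closed under all meets with $x\to s\in S$ for all $x\in L$, $s\in S$; it is itself a locale in the induced order. $S$ is dense if its closure (the smallest closed sublocale containing it) is $L$, equivalently $0\in S$. For a sublocale $S$, $\nu_S:L\to S$ is given by $\nu_S(a)=\bigwedge\{s\in S:a\le s\}$. A subbilocale of $(L,L_1,L_2)$ is a triple $(S,S_1,S_2)$ with $S$ a sublocale of $L$ and $S_k=\nu_S[L_k]$ ($k=1,2$); it is a bilocale, and it is called dense if $S$ is dense. For $a\in L$, $\mathfrak o(a)=\{a\to x:x\in L\}$ is an open sublocale and $\mathfrak c(a)=\{x\in L:a\le x\}$ a closed sublocale. A sublocale of $L$ is $j$-open if it equals $\mathfrak o(a)$ for some $a\in L_j$; a sublocale $A$ is $i$-dense if $\bigcap\{\mathfrak c(a):a\in L_i,\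 A\subseteq\mathfrak c(a)\}=L$. A bilocale is $(i,j)$-Baire if the intersection of any countably many $i$-dense $j$-open sublocales is $i$-dense. A sublocale of $S$ is $i_S$-dense if it is $i$-dense with respect to the bilocale $(S,S_1,S_2)$. The subbilocale $(S,S_1,S_2)$ is relatively $(i,j)$-Baire if for every collection $\{\mathfrak o(x_n):n\in\mathbb N\}$ of $i$-dense $j$-open sublocales of $L$, the sublocale $S\cap\bigwedge_{n\in\mathbb N}\mathfrak o(x_n)$ is $i_S$-dense. *)

theory Defs
  imports "HOL-Algebra.Complete_Lattice" "HOL-Library.Countable_Set"
begin

(* Lattices carry an explicit carrier set, so that a sublocale S of L is itself an object of the
   same kind, namely L\<lparr>carrier := S\<rparr> (induced order). Isabelle's keywords "locale" and "sublocale"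
   are unrelated to the point-free notions, which are called pf_locale and is_sublocale here. *)

locale pf_locale = complete_lattice +
  assumes meet_Sup_distrib:
    "\<lbrakk>a \<in> carrier L; B \<subseteq> carrier L\<rbrakk> \<Longrightarrow> a \<sqinter> \<Squnion>B = \<Squnion>{a \<sqinter> b | b. b \<in> B}"

definition heyting_imp :: "('a, 'm) gorder_scheme \<Rightarrow> 'a \<Rightarrow> 'a \<Rightarrow> 'a" where
  "heyting_imp L a b = \<Squnion>\<^bsub>L\<^esub>{x \<in> carrier L. x \<sqinter>\<^bsub>L\<^esub> a \<sqsubseteq>\<^bsub>L\<^esub> b}"

(* B = {} and F = {} give the bottom and the top element. *)
definition subframe :: "'a set \<Rightarrow> ('a, 'm) gorder_scheme \<Rightarrow> bool" where
  "subframe M L \<longleftrightarrow> M \<subseteq> carrier L \<and>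
     (\<forall>B. B \<subseteq> M \<longrightarrow> \<Squnion>\<^bsub>L\<^esub>B \<in> M) \<and>
     (\<forall>F. F \<subseteq> M \<and> finite F \<longrightarrow> \<Sqinter>\<^bsub>L\<^esub>F \<in> M)"

(* The triple (L, L_1, L_2) is encoded by L and a function P with P 1 = L_1 and P 2 = L_2;
   the values of P at other indices are irrelevant. *)
definition bilocale :: "('a, 'm) gorder_scheme \<Rightarrow> (nat \<Rightarrow> 'a set) \<Rightarrow> bool" where
  "bilocale L P \<longleftrightarrow> pf_locale L \<and> subframe (P 1) L \<and> subframe (P 2) L \<and>
     (\<forall>a \<in> carrier L.
        a = \<Squnion>\<^bsub>L\<^esub>{a1 \<sqinter>\<^bsub>L\<^esub> a2 | a1 a2. a1 \<in> P 1 \<and> a2 \<in> P 2 \<and> a1 \<sqinter>\<^bsub>L\<^esub> a2 \<sqsubseteq>\<^bsub>L\<^esub> a})"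

definition is_sublocale :: "'a set \<Rightarrow> ('a, 'm) gorder_scheme \<Rightarrow> bool" where
  "is_sublocale S L \<longleftrightarrow> S \<subseteq> carrier L \<and>
     (\<forall>B. B \<subseteq> S \<longrightarrow> \<Sqinter>\<^bsub>L\<^esub>B \<in> S) \<and>
     (\<forall>x \<in> carrier L. \<forall>s \<in> S. heyting_imp L x s \<in> S)"

definition open_sl :: "('a, 'm) gorder_scheme \<Rightarrow> 'a \<Rightarrow> 'a set" where
  "open_sl L a = {heyting_imp L a x | x. x \<in> carrier L}"

definition closed_sl :: "('a, 'm) gorder_scheme \<Rightarrow> 'a \<Rightarrow> 'a set" where
  "closed_sl L a = {x \<in> carrier L. a \<sqsubseteq>\<^bsub>L\<^esub> x}"

(* An intersection of closed sublocales is again closed, so this is the smallest closed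
   sublocale containing S. *)
definition sl_closure :: "('a, 'm) gorder_scheme \<Rightarrow> 'a set \<Rightarrow> 'a set" where
  "sl_closure L S = \<Inter>{closed_sl L a | a. a \<in> carrier L \<and> S \<subseteq> closed_sl L a}"

definition dense_sl :: "('a, 'm) gorder_scheme \<Rightarrow> 'a set \<Rightarrow> bool" where
  "dense_sl L S \<longleftrightarrow> sl_closure L S = carrier L"

definition nucleus :: "('a, 'm) gorder_scheme \<Rightarrow> 'a set \<Rightarrow> 'a \<Rightarrow> 'a" where
  "nucleus L S a = \<Sqinter>\<^bsub>L\<^esub>{s \<in> S. a \<sqsubseteq>\<^bsub>L\<^esub> s}"

definition subbilocale ::
  "'a set \<Rightarrow> (nat \<Rightarrow> 'a set) \<Rightarrow> ('a, 'm) gorder_scheme \<Rightarrow> (nat \<Rightarrow> 'a set) \<Rightarrow> bool" where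
  "subbilocale S Q L P \<longleftrightarrow> is_sublocale S L \<and> (\<forall>k \<in> {1, 2}. Q k = nucleus L S ` P k)"

definition j_open :: "('a, 'm) gorder_scheme \<Rightarrow> (nat \<Rightarrow> 'a set) \<Rightarrow> nat \<Rightarrow> 'a set \<Rightarrow> bool" where
  "j_open L P j A \<longleftrightarrow> (\<exists>a \<in> P j. A = open_sl L a)"

(* Meant for sublocales A of L. For a bilocale and i in {1, 2} the intersected family is
   nonempty, as it contains closed_sl L 0 = L. *)
definition i_dense :: "('a, 'm) gorder_scheme \<Rightarrow> (nat \<Rightarrow> 'a set) \<Rightarrow> nat \<Rightarrow> 'a set \<Rightarrow> bool" where
  "i_dense L P i A \<longleftrightarrow> \<Inter>{closed_sl L a | a. a \<in> P i \<and> A \<subseteq> closed_sl L a} = carrier L"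

(* The empty intersection of sublocales of L is L itself. *)
definition baire :: "('a, 'm) gorder_scheme \<Rightarrow> (nat \<Rightarrow> 'a set) \<Rightarrow> nat \<Rightarrow> nat \<Rightarrow> bool" where
  "baire L P i j \<longleftrightarrow>
     (\<forall>U. countable U \<and> (\<forall>A \<in> U. i_dense L P i A \<and> j_open L P j A)
        \<longrightarrow> i_dense L P i (carrier L \<inter> \<Inter>U))"

(* Meets of sublocales are intersections. *)
definition relatively_baire ::
  "'a set \<Rightarrow> (nat \<Rightarrow> 'a set) \<Rightarrow> ('a, 'm) gorder_scheme \<Rightarrow> (nat \<Rightarrow> 'a set) \<Rightarrow> nat \<Rightarrow> nat \<Rightarrow> bool" where
  "relatively_baire S Q L P i j \<longleftrightarrow>
     (\<forall>x :: nat \<Rightarrow> 'a.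
        (\<forall>n. x n \<in> carrier L \<and> i_dense L P i (open_sl L (x n)) \<and> j_open L P j (open_sl L (x n)))
        \<longrightarrow> i_dense (L\<lparr>carrier := S\<rparr>) Q i (S \<inter> (\<Inter>n. open_sl L (x n))))"

end

theory Submission
  imports Defs
begin

text \<open>
  Let \<open>0\<close> be the bottom of \<open>L\<close>. The least element of \<open>\<oo>(x)\<close> is \<open>x \<rightarrow> 0\<close>, and it lies in every
  dense sublocale \<open>S\<close>, because \<open>0 \<in> S\<close>. Hence \<open>\<oo>(x)\<close> and \<open>S \<inter> \<oo>(x)\<close> have the same lower bounds
  in \<open>L\<close>. Density of a set only depends on its lower bounds, and \<open>\<nu>\<close> neither changes which elements
  lie below a member of \<open>S\<close> nor sends a nonzero element to \<open>0\<close>; so \<open>\<oo>(x)\<close> is \<open>i\<close>-dense in \<open>L\<close> iff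
  \<open>S \<inter> \<oo>(x)\<close> is \<open>i\<close>-dense in \<open>S\<close>. Since \<open>S \<inter> \<oo>(x)\<close> is the open sublocale of \<open>S\<close> given by \<open>\<nu>(x)\<close>,
  the two Baire conditions quantify over the same families.
\<close>

section \<open>Density in terms of lower bounds\<close>

text \<open>\<open>A\<close> lies in \<open>closed_sl L a\<close> exactly when \<open>a\<close> is a
  lower bound of \<open>A\<close>, and \<open>closed_sl L a\<close> contains the least element
  \<open>z\<close> only if \<open>a = z\<close>. Asking no more than a partial order with a least
  element lets the criterion apply both to \<open>L\<close> and to \<open>S\<close> with the induced
  order.\<close>

lemma i_dense_iff:
  assumes "partial_order L" and least: "least L z (carrier L)"
    and "P i \<subseteq> carrier L" "z \<in> P i" "A \<subseteq> carrier L"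
  shows "i_dense L P i A \<longleftrightarrow> (\<forall>a \<in> P i. (\<forall>y \<in> A. a \<sqsubseteq>\<^bsub>L\<^esub> y) \<longrightarrow> a = z)"
proof -
  interpret partial_order L by fact
  have z: "z \<in> carrier L" "\<And>x. x \<in> carrier L \<Longrightarrow> z \<sqsubseteq>\<^bsub>L\<^esub> x"
    using least by (auto simp: least_def)
  have closed: "A \<subseteq> closed_sl L a \<longleftrightarrow> (\<forall>y \<in> A. a \<sqsubseteq>\<^bsub>L\<^esub> y)" for a
    using \<open>A \<subseteq> carrier L\<close> by (auto simp: closed_sl_def)
  have cz: "closed_sl L z = carrier L"
    using z by (auto simp: closed_sl_def)
  show ?thesis
  proof
    assume dense: "i_dense L P i A"
    show "\<forall>a \<in> P i. (\<forall>y \<in> A. a \<sqsubseteq>\<^bsub>L\<^esub> y) \<longrightarrow> a = z"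
    proof (intro ballI impI)
      fix a assume a: "a \<in> P i" "\<forall>y \<in> A. a \<sqsubseteq>\<^bsub>L\<^esub> y"
      then have "z \<in> closed_sl L a"
        using dense z closed unfolding i_dense_def by blast
      then show "a = z"
        using a z \<open>P i \<subseteq> carrier L\<close> by (auto simp: closed_sl_def intro!: le_antisym)
    qed
  next
    assume min: "\<forall>a \<in> P i. (\<forall>y \<in> A. a \<sqsubseteq>\<^bsub>L\<^esub> y) \<longrightarrow> a = z"
    have "a \<in> P i \<and> A \<subseteq> closed_sl L a \<longleftrightarrow> a = z" for a
    proof
      show "a = z" if "a \<in> P i \<and> A \<subseteq> closed_sl L a"
        using that min by (simp add: closed)
      show "a \<in> P i \<and> A \<subseteq> closed_sl L a" if "a = z"
        using that cz \<open>z \<in> P i\<close> \<open>A \<subseteq> carrier L\<close> by simp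
    qed
    then show "i_dense L P i A"
      by (simp add: i_dense_def cz)
  qed
qed

section \<open>The order induced on a subset\<close>

lemma (in partial_order) partial_order_subset:
  "A \<subseteq> carrier L \<Longrightarrow> partial_order (L\<lparr>carrier := A\<rparr>)"
  by (simp add: partial_order_def partial_order_axioms_def eq_is_equal
      weak_partial_order_axioms weak_partial_order_subset)

text \<open>Evaluates a join in \<open>S\<close>, where joins may differ from those of
  \<open>L\<close>: the set that defines the Heyting operation has a maximum.\<close>

lemma (in partial_order) sup_eq_maximum:
  assumes "A \<subseteq> carrier L" "m \<in> A" "\<And>x. x \<in> A \<Longrightarrow> x \<sqsubseteq> m"
  shows "\<Squnion>A = m"
proof -
  have "least L m (Upper L A)"
    using assms by (intro least_UpperI) auto
  then show ?thesis
    unfolding sup_def by (blast intro: least_unique)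
qed

text \<open>The greatest lower bound taken in \<open>L\<close> remains greatest among the lower
  bounds lying in \<open>S\<close>, provided it lies in \<open>S\<close> itself.\<close>

lemma (in complete_lattice) inf_subset_eq:
  assumes S: "S \<subseteq> carrier L" and "B \<subseteq> S" "\<Sqinter>B \<in> S"
  shows "\<Sqinter>\<^bsub>L\<lparr>carrier := S\<rparr>\<^esub>B = \<Sqinter>B"
proof -
  interpret S: partial_order "L\<lparr>carrier := S\<rparr>"
    using S by (rule partial_order_subset)
  have B: "B \<subseteq> carrier L" using assms by blast
  have "greatest (L\<lparr>carrier := S\<rparr>) (\<Sqinter>B) (Lower (L\<lparr>carrier := S\<rparr>) B)"
  proof (rule greatest_LowerI)
    fix y assume "y \<in> Lower (L\<lparr>carrier := S\<rparr>) B"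
    then have "y \<in> S" "\<And>b. b \<in> B \<Longrightarrow> y \<sqsubseteq> b"
      using \<open>B \<subseteq> S\<close> by (auto simp: Lower_def)
    then show "y \<sqsubseteq>\<^bsub>L\<lparr>carrier := S\<rparr>\<^esub> \<Sqinter>B"
      using B S by (auto intro: inf_greatest)
  qed (use assms B in \<open>auto intro: inf_lower\<close>)
  then show ?thesis
    unfolding inf_def[of "L\<lparr>carrier := S\<rparr>"] by (blast intro: S.greatest_unique)
qed

section \<open>Heyting implication\<close>

context pf_locale
begin

lemma heyting_imp_closed [simp]: "heyting_imp L a b \<in> carrier L"
  unfolding heyting_imp_def by (rule sup_closed) auto

text \<open>The infinite distributive law shows that the join \<open>\<Squnion>B\<close> defining
  the implication still satisfies \<open>a \<sqinter> \<Squnion>B \<sqsubseteq> b\<close>, so it is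
  the largest member of \<open>B\<close>.\<close>

lemma le_heyting_imp_iff:
  assumes "x \<in> carrier L" "a \<in> carrier L" "b \<in> carrier L"
  shows "x \<sqsubseteq> heyting_imp L a b \<longleftrightarrow> x \<sqinter> a \<sqsubseteq> b"
proof
  define B where "B = {x \<in> carrier L. x \<sqinter> a \<sqsubseteq> b}"
  have B: "B \<subseteq> carrier L" by (auto simp: B_def)
  have imp: "heyting_imp L a b = \<Squnion>B"
    by (simp add: B_def heyting_imp_def)
  show "x \<sqsubseteq> heyting_imp L a b" if "x \<sqinter> a \<sqsubseteq> b"
    unfolding imp using B that assms by (intro sup_upper) (auto simp: B_def)
  have "a \<sqinter> \<Squnion>B = \<Squnion>{a \<sqinter> y | y. y \<in> B}"
    using B assms by (intro meet_Sup_distrib)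
  also have "\<dots> \<sqsubseteq> b"
    using assms B by (intro sup_least) (auto simp: B_def meet_comm)
  finally have le: "a \<sqinter> \<Squnion>B \<sqsubseteq> b" .
  show "x \<sqinter> a \<sqsubseteq> b" if "x \<sqsubseteq> heyting_imp L a b"
  proof -
    have SB: "\<Squnion>B \<in> carrier L" using B by simp
    have "x \<sqinter> a \<sqsubseteq> a \<sqinter> \<Squnion>B"
      using assms SB that unfolding imp
      by (meson le_trans meet_closed meet_le meet_left meet_right)
    then show ?thesis
      using le assms SB by (meson le_trans meet_closed)
  qed
qed

lemma heyting_imp_le: "\<lbrakk>a \<in> carrier L; b \<in> carrier L\<rbrakk> \<Longrightarrow> heyting_imp L a b \<sqinter> a \<sqsubseteq> b"
  using le_heyting_imp_iff[of "heyting_imp L a b" a b] by simp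

text \<open>Meeting with \<open>a\<close> twice is the same as meeting with it once.\<close>

lemma heyting_imp_idem:
  assumes "a \<in> carrier L" "b \<in> carrier L"
  shows "heyting_imp L a (heyting_imp L a b) = heyting_imp L a b"
proof (rule le_antisym)
  let ?c = "heyting_imp L a (heyting_imp L a b)"
  have "?c \<sqinter> a \<sqsubseteq> heyting_imp L a b \<sqinter> a"
    using assms by (intro meet_le heyting_imp_le meet_right) auto
  then have "?c \<sqinter> a \<sqsubseteq> b"
    using heyting_imp_le[OF assms] assms by (meson heyting_imp_closed le_trans meet_closed)
  then show "?c \<sqsubseteq> heyting_imp L a b"
    using assms by (simp add: le_heyting_imp_iff)
  show "heyting_imp L a b \<sqsubseteq> ?c"
    using assms heyting_imp_le[OF assms]
    by (simp add: le_heyting_imp_iff) (meson heyting_imp_closed le_trans meet_closed meet_left)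
qed auto

lemma heyting_imp_mono:
  assumes "a \<in> carrier L" "b \<in> carrier L" "c \<in> carrier L" "b \<sqsubseteq> c"
  shows "heyting_imp L a b \<sqsubseteq> heyting_imp L a c"
proof -
  have "heyting_imp L a b \<sqinter> a \<sqsubseteq> c"
    using heyting_imp_le[of a b] assms by (meson heyting_imp_closed le_trans meet_closed)
  then show ?thesis
    using assms by (simp add: le_heyting_imp_iff)
qed

lemma heyting_imp_top [simp]:
  assumes "b \<in> carrier L"
  shows "heyting_imp L \<top> b = b"
proof (rule le_antisym)
  have "heyting_imp L \<top> b \<sqsubseteq> heyting_imp L \<top> b \<sqinter> \<top>"
    by (intro meet_le) auto
  then show "heyting_imp L \<top> b \<sqsubseteq> b"
    using heyting_imp_le[of \<top> b] assms by (meson heyting_imp_closed le_trans meet_closed top_closed)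
  show "b \<sqsubseteq> heyting_imp L \<top> b"
    using assms by (simp add: le_heyting_imp_iff meet_left)
qed (use assms in auto)

section \<open>Open sublocales and the bounds of a subframe\<close>

lemma open_sl_subset: "open_sl L a \<subseteq> carrier L"
  by (auto simp: open_sl_def)

text \<open>By idempotence, the image of \<open>heyting_imp L a\<close> is its set of fixed
  points.\<close>

lemma mem_open_sl_iff:
  "a \<in> carrier L \<Longrightarrow> y \<in> open_sl L a \<longleftrightarrow> y \<in> carrier L \<and> heyting_imp L a y = y"
  unfolding open_sl_def using heyting_imp_idem by force

lemma subframe_bottom: "subframe M L \<Longrightarrow> \<bottom> \<in> M"
  unfolding subframe_def using weak_sup_empty by (metis empty_subsetI eq_is_equal)

lemma subframe_top: "subframe M L \<Longrightarrow> \<top> \<in> M"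
  unfolding subframe_def using weak_inf_empty by (metis empty_subsetI eq_is_equal finite.emptyI)

section \<open>Dense sublocales and the nucleus\<close>

text \<open>\<open>S\<close> is contained in the closed sublocale of its own meet. Density puts
  \<open>\<bottom>\<close> into that closed sublocale, so the meet, which belongs to
  \<open>S\<close>, is \<open>\<bottom>\<close>.\<close>

lemma dense_sl_bottom:
  assumes "dense_sl L S" "is_sublocale S L"
  shows "\<bottom> \<in> S"
proof -
  have S: "S \<subseteq> carrier L" "\<Sqinter>S \<in> S"
    using assms by (auto simp: is_sublocale_def)
  have "S \<subseteq> closed_sl L (\<Sqinter>S)"
    using S by (auto simp: closed_sl_def intro: inf_lower)
  then have "sl_closure L S \<subseteq> closed_sl L (\<Sqinter>S)"
    using S unfolding sl_closure_def by blast
  then have "\<Sqinter>S \<sqsubseteq> \<bottom>"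
    using assms(1) by (auto simp: dense_sl_def closed_sl_def)
  then have "\<Sqinter>S = \<bottom>"
    using S by (metis bottom_closed bottom_lower le_antisym subsetD)
  then show ?thesis using S by simp
qed

lemma nucleus_mem: "is_sublocale S L \<Longrightarrow> nucleus L S a \<in> S"
  by (simp add: is_sublocale_def nucleus_def)

text \<open>The nucleus is left adjoint to the inclusion of \<open>S\<close> into
  \<open>L\<close>.\<close>

lemma nucleus_le_iff:
  assumes "is_sublocale S L" "a \<in> carrier L" "s \<in> S"
  shows "nucleus L S a \<sqsubseteq> s \<longleftrightarrow> a \<sqsubseteq> s"
proof
  have S: "S \<subseteq> carrier L" using assms by (simp add: is_sublocale_def)
  have "a \<sqsubseteq> nucleus L S a"
    unfolding nucleus_def using S assms by (intro inf_greatest) auto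
  then show "a \<sqsubseteq> s" if "nucleus L S a \<sqsubseteq> s"
    using that assms S nucleus_mem[OF assms(1), of a] by (meson le_trans subsetD)
  show "nucleus L S a \<sqsubseteq> s" if "a \<sqsubseteq> s"
    unfolding nucleus_def using S assms that by (intro inf_lower) auto
qed

lemma nucleus_eq_bottom_iff:
  assumes "is_sublocale S L" "\<bottom> \<in> S" "a \<in> carrier L"
  shows "nucleus L S a = \<bottom> \<longleftrightarrow> a = \<bottom>"
proof -
  have le_bottom: "x \<sqsubseteq> \<bottom> \<longleftrightarrow> x = \<bottom>" if "x \<in> carrier L" for x
    using that by (metis bottom_closed bottom_lower le_antisym)
  have "nucleus L S a \<in> carrier L"
    using nucleus_mem assms unfolding is_sublocale_def by blast
  then show ?thesis
    using nucleus_le_iff[OF assms(1,3,2)] assms(3) by (simp add: le_bottom)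
qed

section \<open>Implication and open sublocales computed inside a sublocale\<close>

text \<open>Binary meets in \<open>S\<close> are those of \<open>L\<close>, and
  \<open>heyting_imp L a b\<close> lies in \<open>S\<close>, so it is also the largest
  \<open>x\<close> in \<open>S\<close> whose meet with \<open>a\<close> is below
  \<open>b\<close>.\<close>

lemma heyting_imp_sublocale:
  assumes "is_sublocale S L" "a \<in> S" "b \<in> S"
  shows "heyting_imp (L\<lparr>carrier := S\<rparr>) a b = heyting_imp L a b"
proof -
  have S: "S \<subseteq> carrier L" "\<And>B. B \<subseteq> S \<Longrightarrow> \<Sqinter>B \<in> S" "heyting_imp L a b \<in> S"
    using assms by (auto simp: is_sublocale_def)
  interpret S: partial_order "L\<lparr>carrier := S\<rparr>"
    using S(1) by (rule partial_order_subset)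
  have meet: "x \<sqinter>\<^bsub>L\<lparr>carrier := S\<rparr>\<^esub> a = x \<sqinter> a" if "x \<in> S" for x
    unfolding meet_def using that assms S by (intro inf_subset_eq) auto
  show ?thesis
    unfolding heyting_imp_def[of "L\<lparr>carrier := S\<rparr>"]
  proof (rule S.sup_eq_maximum)
    show "heyting_imp L a b \<in> {x \<in> carrier (L\<lparr>carrier := S\<rparr>).
        x \<sqinter>\<^bsub>L\<lparr>carrier := S\<rparr>\<^esub> a \<sqsubseteq>\<^bsub>L\<lparr>carrier := S\<rparr>\<^esub> b}"
      using S assms heyting_imp_le[of a b] by (auto simp: meet)
  next
    fix x assume "x \<in> {x \<in> carrier (L\<lparr>carrier := S\<rparr>).
        x \<sqinter>\<^bsub>L\<lparr>carrier := S\<rparr>\<^esub> a \<sqsubseteq>\<^bsub>L\<lparr>carrier := S\<rparr>\<^esub> b}"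
    then have "x \<in> S" "x \<sqinter> a \<sqsubseteq> b" by (auto simp: meet)
    then show "x \<sqsubseteq>\<^bsub>L\<lparr>carrier := S\<rparr>\<^esub> heyting_imp L a b"
      using S(1) assms by (auto simp: le_heyting_imp_iff subset_iff)
  qed auto
qed

text \<open>The relation \<open>x \<sqsubseteq> heyting_imp L y s\<close> is symmetric in
  \<open>x\<close> and \<open>y\<close>. Swapping moves the nucleus to the left of
  \<open>heyting_imp L x s\<close>, an element of \<open>S\<close>, where the adjunction removes
  it.\<close>

lemma heyting_imp_nucleus:
  assumes "is_sublocale S L" "a \<in> carrier L" "s \<in> S"
  shows "heyting_imp L (nucleus L S a) s = heyting_imp L a s"
proof -
  have S: "S \<subseteq> carrier L" and imp: "\<And>x. x \<in> carrier L \<Longrightarrow> heyting_imp L x s \<in> S"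
    using assms by (auto simp: is_sublocale_def)
  have \<nu>: "nucleus L S a \<in> carrier L"
    using S nucleus_mem[OF assms(1)] by blast
  have s: "s \<in> carrier L" using S assms by blast
  have swap: "x \<sqsubseteq> heyting_imp L y s \<longleftrightarrow> y \<sqsubseteq> heyting_imp L x s"
    if "x \<in> carrier L" "y \<in> carrier L" for x y
    using that s by (simp add: le_heyting_imp_iff meet_comm)
  have "x \<sqsubseteq> heyting_imp L (nucleus L S a) s \<longleftrightarrow> x \<sqsubseteq> heyting_imp L a s"
    if x: "x \<in> carrier L" for x
    using swap[OF x] \<nu> assms(2) nucleus_le_iff[OF assms(1,2) imp[OF x]] by simp
  then show ?thesis
    by (meson heyting_imp_closed le_antisym le_refl)
qed

lemma open_sl_sublocale:
  assumes "is_sublocale S L" "a \<in> carrier L"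
  shows "open_sl (L\<lparr>carrier := S\<rparr>) (nucleus L S a) = S \<inter> open_sl L a"
proof -
  have S: "S \<subseteq> carrier L" and imp: "\<And>s. s \<in> S \<Longrightarrow> heyting_imp L a s \<in> S"
    using assms by (auto simp: is_sublocale_def)
  have "heyting_imp (L\<lparr>carrier := S\<rparr>) (nucleus L S a) s = heyting_imp L a s" if "s \<in> S" for s
    using assms that by (simp add: heyting_imp_sublocale heyting_imp_nucleus nucleus_mem)
  then have "open_sl (L\<lparr>carrier := S\<rparr>) (nucleus L S a) = {heyting_imp L a s | s. s \<in> S}"
    by (simp add: open_sl_def Setcompr_eq_image)
  also have "\<dots> = S \<inter> open_sl L a"
  proof
    show "{heyting_imp L a s | s. s \<in> S} \<subseteq> S \<inter> open_sl L a"
      using S imp by (auto simp: open_sl_def)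
    show "S \<inter> open_sl L a \<subseteq> {heyting_imp L a s | s. s \<in> S}"
    proof
      \<comment> \<open>As a fixed point in \<open>S\<close>, \<open>y\<close> is its own
        witness.\<close>
      fix y assume "y \<in> S \<inter> open_sl L a"
      then have "y \<in> S" "y = heyting_imp L a y"
        by (simp_all add: mem_open_sl_iff[OF assms(2)])
      then show "y \<in> {heyting_imp L a s | s. s \<in> S}" by blast
    qed
  qed
  finally show ?thesis .
qed

section \<open>Transfer of density between \<open>L\<close> and \<open>S\<close>\<close>

lemma lower_bounds_dense_open_sl:
  assumes "is_sublocale S L" "\<bottom> \<in> S" "a \<in> carrier L" "x \<in> carrier L"
  shows "(\<forall>y \<in> S \<inter> open_sl L x. a \<sqsubseteq> y) \<longleftrightarrow> (\<forall>y \<in> open_sl L x. a \<sqsubseteq> y)"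
proof
  assume "\<forall>y \<in> S \<inter> open_sl L x. a \<sqsubseteq> y"
  \<comment> \<open>This element is in \<open>S\<close> because \<open>\<bottom>\<close> is, and by
    monotonicity it is the least element of \<open>open_sl L x\<close>.\<close>
  moreover have "heyting_imp L x \<bottom> \<in> S \<inter> open_sl L x"
    using assms by (auto simp: is_sublocale_def open_sl_def)
  ultimately have a: "a \<sqsubseteq> heyting_imp L x \<bottom>" by blast
  show "\<forall>y \<in> open_sl L x. a \<sqsubseteq> y"
  proof
    fix y assume "y \<in> open_sl L x"
    then obtain z where "z \<in> carrier L" "y = heyting_imp L x z"
      by (auto simp: open_sl_def)
    then show "a \<sqsubseteq> y"
      using a assms heyting_imp_mono[of x \<bottom> z]
      by (meson bottom_closed bottom_lower heyting_imp_closed le_trans)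
  qed
qed auto

text \<open>Density in \<open>S\<close> is tested on \<open>P i\<close> instead of its image
  \<open>Q i\<close>, so that it can be compared directly with density in \<open>L\<close>.\<close>

lemma i_dense_sublocale_iff:
  assumes S: "is_sublocale S L" "\<bottom> \<in> S" and "subframe (P i) L"
    and Q: "Q i = nucleus L S ` P i" and "A \<subseteq> S"
  shows "i_dense (L\<lparr>carrier := S\<rparr>) Q i A \<longleftrightarrow> (\<forall>a \<in> P i. (\<forall>y \<in> A. a \<sqsubseteq> y) \<longrightarrow> a = \<bottom>)"
proof -
  have SL: "S \<subseteq> carrier L" using S by (simp add: is_sublocale_def)
  have P: "P i \<subseteq> carrier L" "\<bottom> \<in> P i"
    using assms(3) subframe_bottom by (auto simp: subframe_def)
  have "partial_order (L\<lparr>carrier := S\<rparr>)"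
    using SL by (rule partial_order_subset)
  moreover have "least (L\<lparr>carrier := S\<rparr>) \<bottom> (carrier (L\<lparr>carrier := S\<rparr>))"
    using SL S by (auto simp: least_def)
  moreover have "Q i \<subseteq> S"
    using Q nucleus_mem[OF S(1)] by auto
  moreover have "\<bottom> \<in> Q i"
    using nucleus_eq_bottom_iff[OF S bottom_closed] P(2) unfolding Q image_iff by metis
  ultimately have "i_dense (L\<lparr>carrier := S\<rparr>) Q i A \<longleftrightarrow>
      (\<forall>b \<in> Q i. (\<forall>y \<in> A. b \<sqsubseteq> y) \<longrightarrow> b = \<bottom>)"
    using i_dense_iff[of "L\<lparr>carrier := S\<rparr>" \<bottom> Q i A] \<open>A \<subseteq> S\<close> by simp
  also have "\<dots> \<longleftrightarrow> (\<forall>a \<in> P i. (\<forall>y \<in> A. nucleus L S a \<sqsubseteq> y) \<longrightarrow> nucleus L S a = \<bottom>)"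
    by (simp add: Q)
  also have "\<dots> \<longleftrightarrow> (\<forall>a \<in> P i. (\<forall>y \<in> A. a \<sqsubseteq> y) \<longrightarrow> a = \<bottom>)"
  proof (rule ball_cong[OF HOL.refl])
    fix a assume "a \<in> P i"
    then have a: "a \<in> carrier L" using P(1) by blast
    have "(\<forall>y \<in> A. nucleus L S a \<sqsubseteq> y) \<longleftrightarrow> (\<forall>y \<in> A. a \<sqsubseteq> y)"
      using \<open>A \<subseteq> S\<close> nucleus_le_iff[OF S(1) a] by (intro ball_cong) auto
    then show "((\<forall>y \<in> A. nucleus L S a \<sqsubseteq> y) \<longrightarrow> nucleus L S a = \<bottom>) \<longleftrightarrow>
        ((\<forall>y \<in> A. a \<sqsubseteq> y) \<longrightarrow> a = \<bottom>)"
      by (simp only: nucleus_eq_bottom_iff[OF S a])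
  qed
  finally show ?thesis .
qed

lemma i_dense_open_sl_sublocale_iff:
  assumes S: "is_sublocale S L" "\<bottom> \<in> S" and "subframe (P i) L"
    and Q: "Q i = nucleus L S ` P i" and x: "x \<in> carrier L"
  shows "i_dense (L\<lparr>carrier := S\<rparr>) Q i (S \<inter> open_sl L x) \<longleftrightarrow> i_dense L P i (open_sl L x)"
proof -
  have P: "P i \<subseteq> carrier L" "\<bottom> \<in> P i"
    using assms(3) subframe_bottom by (auto simp: subframe_def)
  have "i_dense L P i (open_sl L x) \<longleftrightarrow>
      (\<forall>a \<in> P i. (\<forall>y \<in> open_sl L x. a \<sqsubseteq> y) \<longrightarrow> a = \<bottom>)"
    using P by (intro i_dense_iff partial_order_axioms bottom_least open_sl_subset)
  also have "\<dots> \<longleftrightarrow> (\<forall>a \<in> P i. (\<forall>y \<in> S \<inter> open_sl L x. a \<sqsubseteq> y) \<longrightarrow> a = \<bottom>)"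
    by (rule ball_cong[OF HOL.refl]) (use P(1) lower_bounds_dense_open_sl[OF S _ x] in blast)
  also have "\<dots> \<longleftrightarrow> i_dense (L\<lparr>carrier := S\<rparr>) Q i (S \<inter> open_sl L x)"
    using assms by (intro i_dense_sublocale_iff[symmetric]) auto
  finally show ?thesis ..
qed

section \<open>Comparison of the two Baire conditions\<close>

lemma j_open_sublocale_iff:
  assumes "is_sublocale S L" "P j \<subseteq> carrier L" "Q j = nucleus L S ` P j"
  shows "j_open (L\<lparr>carrier := S\<rparr>) Q j A \<longleftrightarrow> (\<exists>a \<in> P j. A = S \<inter> open_sl L a)"
  using assms open_sl_sublocale[OF assms(1)] unfolding j_open_def by (auto simp: subset_iff)

lemma baire_iff_relatively_baire:
  assumes S: "is_sublocale S L" "\<bottom> \<in> S" and P: "subframe (P i) L" "subframe (P j) L"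
    and Q: "Q i = nucleus L S ` P i" "Q j = nucleus L S ` P j"
  shows "baire (L\<lparr>carrier := S\<rparr>) Q i j \<longleftrightarrow> relatively_baire S Q L P i j"
proof
  have Pj: "P j \<subseteq> carrier L" using P by (simp add: subframe_def)
  note dense_iff = i_dense_open_sl_sublocale_iff[where P = P and i = i and Q = Q, OF S P(1) Q(1)]
  note open_iff = j_open_sublocale_iff[where P = P and j = j and Q = Q, OF S(1) Pj Q(2)]
  {
    assume baire: "baire (L\<lparr>carrier := S\<rparr>) Q i j"
    show "relatively_baire S Q L P i j"
      unfolding relatively_baire_def
    proof (intro allI impI)
      fix x :: "nat \<Rightarrow> 'a"
      assume x: "\<forall>n. x n \<in> carrier L \<and> i_dense L P i (open_sl L (x n)) \<and>
        j_open L P j (open_sl L (x n))"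
      define U where "U = range (\<lambda>n. S \<inter> open_sl L (x n))"
      have "countable U" by (simp add: U_def)
      \<comment> \<open>The generator in \<open>P j\<close> is extracted from
        \<open>j_open_def\<close>, since the assumption speaks of the sublocale
        \<open>open_sl L (x n)\<close> being \<open>j\<close>-open.\<close>
      moreover have "i_dense (L\<lparr>carrier := S\<rparr>) Q i A" "j_open (L\<lparr>carrier := S\<rparr>) Q j A"
        if "A \<in> U" for A
        using that x dense_iff by (auto simp: U_def open_iff) (metis j_open_def)
      ultimately have "i_dense (L\<lparr>carrier := S\<rparr>) Q i (S \<inter> \<Inter>U)"
        using baire unfolding baire_def by simp
      moreover have "S \<inter> \<Inter>U = S \<inter> (\<Inter>n. open_sl L (x n))"
        by (auto simp: U_def)
      ultimately show "i_dense (L\<lparr>carrier := S\<rparr>) Q i (S \<inter> (\<Inter>n. open_sl L (x n)))"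
        by simp
    qed
  }
  {
    assume rel: "relatively_baire S Q L P i j"
    show "baire (L\<lparr>carrier := S\<rparr>) Q i j"
      unfolding baire_def
    proof (intro allI impI, elim conjE)
      fix U assume "countable U"
        and U: "\<forall>A \<in> U. i_dense (L\<lparr>carrier := S\<rparr>) Q i A \<and> j_open (L\<lparr>carrier := S\<rparr>) Q j A"
      \<comment> \<open>Each member of \<open>U\<close> is the trace on \<open>S\<close> of a
        \<open>j\<close>-open sublocale of \<open>L\<close>; \<open>f\<close> chooses a
        generator.\<close>
      obtain f where f: "\<And>A. A \<in> U \<Longrightarrow> f A \<in> P j" "\<And>A. A \<in> U \<Longrightarrow> A = S \<inter> open_sl L (f A)"
        using U unfolding open_iff by metis
      \<comment> \<open>The top element makes \<open>V\<close> nonempty, as required for enumerating it, even if \<open>U = {}\<close>.\<close>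
      define V where "V = insert \<top> (f ` U)"
      define x where "x = from_nat_into V"
      have ran: "range x = V"
        unfolding x_def by (rule range_from_nat_into) (use \<open>countable U\<close> in \<open>auto simp: V_def\<close>)
      have open_top: "open_sl L \<top> = carrier L"
        by (auto simp: mem_open_sl_iff)
      have V: "v \<in> P j \<and> i_dense L P i (open_sl L v)" if v: "v \<in> V" for v
      proof (cases "v = \<top>")
        case True
        \<comment> \<open>The carrier contains \<open>\<bottom>\<close>, so its only lower bound is
          \<open>\<bottom>\<close>.\<close>
        have "i_dense L P i (carrier L)"
          using P(1) subframe_bottom[OF P(1)] unfolding subframe_def
          by (subst i_dense_iff[OF partial_order_axioms bottom_least])
            (auto intro!: le_antisym)
        then show ?thesis
          using True open_top P(2) subframe_top by simp
      next
        case False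
        then obtain A where "A \<in> U" "v = f A" using v by (auto simp: V_def)
        then show ?thesis
          using f U dense_iff Pj by (metis subsetD)
      qed
      have "x n \<in> V" for n using ran by blast
      then have "i_dense (L\<lparr>carrier := S\<rparr>) Q i (S \<inter> (\<Inter>n. open_sl L (x n)))"
        using rel V Pj unfolding relatively_baire_def j_open_def by blast
      moreover have "S \<inter> (\<Inter>n. open_sl L (x n)) = S \<inter> (\<Inter>v \<in> V. open_sl L v)"
        by (simp flip: ran)
      \<comment> \<open>The added \<open>\<top>\<close> contributes the whole carrier, which leaves
        the intersection with \<open>S\<close> unchanged.\<close>
      moreover have "\<dots> = S \<inter> \<Inter>U"
      proof -
        have "x \<in> open_sl L (f A) \<longleftrightarrow> x \<in> A" if "x \<in> S" "A \<in> U" for x A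
          using that f(2)[of A] by blast
        moreover have "S \<subseteq> carrier L"
          using S(1) by (simp add: is_sublocale_def)
        ultimately show ?thesis
          by (auto simp: V_def open_top)
      qed
      ultimately show "i_dense (L\<lparr>carrier := S\<rparr>) Q i (carrier (L\<lparr>carrier := S\<rparr>) \<inter> \<Inter>U)"
        by simp
    qed
  }
qed

end

theorem proposition3p9:
  fixes L :: "'a gorder" and P Q :: "nat \<Rightarrow> 'a set" and S :: "'a set" and i j :: nat
  assumes "{i, j} = {1, 2}"
    and "bilocale L P"
    and "subbilocale S Q L P"
    and "dense_sl L S"
  shows "baire (L\<lparr>carrier := S\<rparr>) Q i j \<longleftrightarrow> relatively_baire S Q L P i j"
proof -
  have ij: "i \<in> {1, 2}" "j \<in> {1, 2}"
    using assms(1) by blast+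
  interpret pf_locale L
    using assms(2) by (simp add: bilocale_def)
  show ?thesis
    using assms(2-4) ij
    by (intro baire_iff_relatively_baire dense_sl_bottom)
      (auto simp: bilocale_def subbilocale_def)
qed

end
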